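(* Let $G=\prod_{n\in\mathbb N}G_{p_n}$. Then the graph $\Delta_{\mathrm{virt}}(G)$ has $2^{\aleph_0}$ different connected components.
   Context: For a prime $p$, let $G_p=(\mathrm{SL}(2,2^p))^{\delta_p}$, where $\delta_p$ is the largest positive integer such that the direct power $(\mathrm{SL}(2,2^p))^{\delta_p}$ can be generated by 2 elements. For a 2-generated finite group $X$, the generating graph $\Gamma(X)$ has vertex set $X$, with two elements adjacent if and only if they generate $X$; $\Delta(X)$ is the subgraph obtained by removing the isolated vertices of $\Gamma(X)$. It is known that $\Delta(G_p)$ is connected for every prime $p$ and that there exists an increasing sequence $(p_n)_{n\in\mathbb N}$ of odd primes with $\operatorname{diam}(\Delta(G_{p_n}))\geq 2^n$ for every $n\in\mathbb N$; such a sequence is fixed. $G=\prod_{n\in\mathbb N}G_{p_n}$ is the cartesian product with the product topology (each $G_{p_n}$ discrete), a profinite group. For a profinite group $G$, $\Gamma_{\mathrm{virt}}(G)$ is the graph whose vertices are the elements of $G$ and in which two vertices $x,y$ are adjacent if and only if the closed subgroup $\langle x,y\rangle$ topologically generated by $x$ and $y$ is open in $G$; $\Delta_{\mathrm{virt}}(G)$ is the subgraph obtained by removing the isolated vertices. *)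

theory Defs
  imports
    "HOL-Analysis.Analysis"
    "HOL-Algebra.Algebra"
    "HOL-Algebra.Algebraic_Closure_Type"
    "HOL-Library.Z2"
    "HOL-Library.Equipollence"
    "Graph_Theory.Graph_Theory"
begin

no_notation fps_nth (infixl "$" 75)

section \<open>The groups \<open>SL(2, 2\<^sup>k)\<close>\<close>

text \<open>The field with \<open>2\<^sup>k\<close> elements (for \<open>k > 0\<close>), realised inside the algebraic closure of
  the field \<^typ>\<open>bit\<close> with two elements.\<close>

definition GF2 :: "nat \<Rightarrow> bit alg_closure set"
  where "GF2 k = {x. x ^ (2 ^ k) = x}"

lemma CHAR_bit: "CHAR(bit) = 2"
  by (rule CHAR_eq_posI) (auto simp: less_2_cases_iff)

lemma GF2_0: "0 \<in> GF2 k"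
  by (simp add: GF2_def)

lemma GF2_1: "1 \<in> GF2 k"
  by (simp add: GF2_def)

lemma GF2_add: "x \<in> GF2 k \<Longrightarrow> y \<in> GF2 k \<Longrightarrow> x + y \<in> GF2 k"
  using freshmans_dream'[of "2 ^ k" k x y] by (simp add: GF2_def CHAR_bit)

lemma uminus_eq: "- x = (x :: bit alg_closure)"
proof -
  have "of_nat (CHAR(bit alg_closure)) = (0 :: bit alg_closure)"
    by (rule of_nat_CHAR)
  hence "1 + 1 = (0 :: bit alg_closure)"
    by (simp add: CHAR_bit)
  hence "x + x = 0"
    by (metis distrib_left mult.right_neutral mult_zero_right)
  thus ?thesis
    by (simp add: eq_neg_iff_add_eq_0 minus_equation_iff)
qed

lemma GF2_uminus: "x \<in> GF2 k \<Longrightarrow> - x \<in> GF2 k"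
  by (simp add: uminus_eq)

lemma GF2_mult: "x \<in> GF2 k \<Longrightarrow> y \<in> GF2 k \<Longrightarrow> x * y \<in> GF2 k"
  by (simp add: GF2_def power_mult_distrib)

lemma GF2_inverse: "x \<in> GF2 k \<Longrightarrow> inverse x \<in> GF2 k"
  by (simp add: GF2_def power_inverse)

lemma card_GF2:
  assumes "k > 0"
  shows "card (GF2 k) = 2 ^ k"
proof -
  define P :: "bit alg_closure poly" where "P = Polynomial.monom 1 (2 ^ k) + [:0, -1:]"
  have "(2::nat) ^ 1 \<le> 2 ^ k"
    using assms by (intro power_increasing) auto
  hence deg_less: "Polynomial.degree [:0, -1 :: bit alg_closure:] < Polynomial.degree (Polynomial.monom (1 :: bit alg_closure) (2 ^ k))"
    by (simp add: Polynomial.degree_monom_eq)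
  have deg: "Polynomial.degree P = 2 ^ k"
    unfolding P_def using deg_less by (subst degree_add_eq_left) (simp_all add: Polynomial.degree_monom_eq)
  hence "P \<noteq> 0" by auto
  have roots: "poly P x = 0 \<longleftrightarrow> x \<in> GF2 k" for x
    by (simp add: P_def GF2_def poly_monom)
  have "of_nat (2 ^ k) = (0 :: bit alg_closure)"
    using assms by (simp add: of_nat_eq_0_iff_char_dvd CHAR_bit del: of_nat_power)
  hence deriv: "pderiv P = [:-1:]"
    by (simp add: P_def pderiv_add pderiv_monom pderiv_pCons del: of_nat_power)
  obtain A where A: "size A = 2 ^ k"
      "P = Polynomial.smult (Polynomial.lead_coeff P) (\<Prod>x\<in>#A. [:- x, 1:])"
    using alg_closed_imp_factorization[OF \<open>P \<noteq> 0\<close>] deg by auto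
  have poly_P: "poly P x = Polynomial.lead_coeff P * (\<Prod>y\<in>#A. x - y)" for x
    by (subst A(2)) (simp add: poly_prod_mset image_mset.compositionality o_def)
  have "set_mset A = GF2 k"
    using \<open>P \<noteq> 0\<close> by (auto simp flip: roots simp: poly_P prod_mset_zero_iff)
  moreover have "count A x \<le> 1" for x
  proof (rule ccontr)
    assume "\<not> count A x \<le> 1"
    hence "replicate_mset 2 x \<subseteq># A"
      by (simp flip: count_le_replicate_mset_subset_eq)
    then obtain B where "A = add_mset x (add_mset x B)"
      by (metis mset_subset_eq_exists_conv replicate_mset_Suc numeral_2_eq_2 replicate_mset_0
          add_mset_add_single union_mset_add_mset_left add_0)
    then obtain Q where Q: "P = [:- x, 1:] * ([:- x, 1:] * Q)"
      using A(2) by (metis (no_types, lifting) image_mset_add_mset mult_smult_right prod_mset.add_mset)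
    have "poly (pderiv P) x = 0"
      unfolding Q by (simp only: pderiv_mult poly_add poly_mult) simp
    thus False by (simp add: deriv)
  qed
  ultimately have "A = mset_set (GF2 k)"
    by (intro multiset_eqI) (metis count_mset_set(1,3) count_eq_zero_iff finite_set_mset
        le_antisym count_greater_eq_one_iff)
  thus ?thesis using A(1) by simp
qed

definition SL :: "'a::comm_ring_1 set \<Rightarrow> ('a ^ 'n ^ 'n) monoid"
  where "SL K = \<lparr>carrier = {A. (\<forall>i j. A $ i $ j \<in> K) \<and> det A = 1}, monoid.mult = (**), one = mat 1\<rparr>"

abbreviation SL2 :: "nat \<Rightarrow> (bit alg_closure ^ 2 ^ 2) monoid"
  where "SL2 k \<equiv> SL (GF2 k)"

lemma group_SL2: "group (SL2 k)"
proof (rule groupI)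
  show "x \<otimes>\<^bsub>SL2 k\<^esub> y \<in> carrier (SL2 k)" if "x \<in> carrier (SL2 k)" "y \<in> carrier (SL2 k)" for x y
    using that det_mul[of x y]
    by (auto simp: SL_def matrix_matrix_mult_def sum_2 intro!: GF2_add GF2_mult)
  show "\<one>\<^bsub>SL2 k\<^esub> \<in> carrier (SL2 k)"
    by (simp add: SL_def det_2 mat_def forall_2 GF2_0 GF2_1)
  show "(x \<otimes>\<^bsub>SL2 k\<^esub> y) \<otimes>\<^bsub>SL2 k\<^esub> z = x \<otimes>\<^bsub>SL2 k\<^esub> (y \<otimes>\<^bsub>SL2 k\<^esub> z)" for x y z
    by (simp add: SL_def matrix_mul_assoc)
  show "\<one>\<^bsub>SL2 k\<^esub> \<otimes>\<^bsub>SL2 k\<^esub> x = x" for x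
    by (simp add: SL_def)
  show "\<exists>y\<in>carrier (SL2 k). y \<otimes>\<^bsub>SL2 k\<^esub> x = \<one>\<^bsub>SL2 k\<^esub>" if x: "x \<in> carrier (SL2 k)" for x
  proof
    let ?y = "vector [vector [x$2$2, - x$1$2], vector [- x$2$1, x$1$1]] :: bit alg_closure ^ 2 ^ 2"
    have d: "x$1$1 * x$2$2 - x$1$2 * x$2$1 = 1"
      using x by (simp add: SL_def det_2)
    show "?y \<in> carrier (SL2 k)"
      using x d by (auto simp: SL_def det_2 forall_2 GF2_uminus algebra_simps)
    show "?y \<otimes>\<^bsub>SL2 k\<^esub> x = \<one>\<^bsub>SL2 k\<^esub>"
      using d by (simp add: SL_def vec_eq_iff forall_2 matrix_matrix_mult_def sum_2 mat_def algebra_simps)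
  qed
qed

lemma finite_SL2:
  assumes "k > 0"
  shows "finite (carrier (SL2 k))"
proof -
  have fin: "finite (GF2 k)"
    using card_GF2[OF assms] by (metis card.infinite power_not_zero zero_neq_numeral)
  let ?f = "\<lambda>A :: bit alg_closure ^ 2 ^ 2. (A$1$1, A$1$2, A$2$1, A$2$2)"
  have "inj ?f"
    unfolding inj_def vec_eq_iff forall_2 prod.inject by blast
  moreover have "?f ` carrier (SL2 k) \<subseteq> GF2 k \<times> GF2 k \<times> GF2 k \<times> GF2 k"
    by (auto simp: SL_def)
  hence "finite (?f ` carrier (SL2 k))"
    by (rule finite_subset) (use fin in auto)
  ultimately show ?thesis
    using finite_imageD[of ?f "carrier (SL2 k)"] inj_on_subset[OF _ subset_UNIV] by blast
qed

definition dir_power :: "('a, 'b) monoid_scheme \<Rightarrow> nat \<Rightarrow> (nat \<Rightarrow> 'a) monoid"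
  where "dir_power H d = product_group {..<d} (\<lambda>_. H)"

definition two_generated :: "('a, 'b) monoid_scheme \<Rightarrow> bool"
  where "two_generated H \<longleftrightarrow> (\<exists>x\<in>carrier H. \<exists>y\<in>carrier H. generate H {x, y} = carrier H)"

lemma two_generated_dir_power_SL2_le:
  assumes "k > 0" and "two_generated (dir_power (SL2 k) d)"
  shows "d \<le> card (carrier (SL2 k) \<times> carrier (SL2 k))"
proof -
  let ?P = "dir_power (SL2 k) d"
  obtain x y where xy: "x \<in> carrier ?P" "y \<in> carrier ?P" and gen: "generate ?P {x, y} = carrier ?P"
    using assms(2) by (auto simp: two_generated_def)
  have inv_P: "(inv\<^bsub>?P\<^esub> z) i = inv\<^bsub>SL2 k\<^esub> (z i)" if "z \<in> carrier ?P" "i < d" for z i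
    using that unfolding dir_power_def by (subst inv_product_group) (auto simp: group_SL2)
  have "inj_on (\<lambda>i. (x i, y i)) {..<d}"
  proof (rule inj_onI, rule ccontr)
    fix i j assume ij: "i \<in> {..<d}" "j \<in> {..<d}" "(x i, y i) = (x j, y j)" "i \<noteq> j"
    have "z i = z j" if "z \<in> generate ?P {x, y}" for z
      using that
    proof induction
      case one
      show ?case using ij by (simp add: dir_power_def)
    next
      case (incl h)
      thus ?case using ij by auto
    next
      case (inv h)
      thus ?case using ij xy by (auto simp: inv_P)
    next
      case (eng h1 h2)
      thus ?case using ij by (simp add: dir_power_def)
    qed
    hence eq: "z i = z j" if "z \<in> carrier ?P" for z
      using that gen by auto
    let ?u = "vector [vector [1, 1], vector [0, 1]] :: bit alg_closure ^ 2 ^ 2"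
    have "?u \<in> carrier (SL2 k)"
      by (simp add: SL_def det_2 forall_2 GF2_0 GF2_1)
    moreover have "mat 1 \<in> carrier (SL2 k)"
      by (simp add: SL_def det_2 mat_def forall_2 GF2_0 GF2_1)
    ultimately have "(\<lambda>l\<in>{..<d}. if l = i then ?u else mat 1) \<in> carrier ?P"
      unfolding dir_power_def carrier_product_group by (intro restrict_PiE_iff[THEN iffD2]) simp
    from eq[OF this] have "?u = mat 1"
      using ij by (auto split: if_splits)
    hence "?u $ 1 $ 2 = (mat 1 :: bit alg_closure ^ 2 ^ 2) $ 1 $ 2"
      by (rule arg_cong)
    thus False
      by (simp add: mat_def)
  qed
  moreover have "(\<lambda>i. (x i, y i)) ` {..<d} \<subseteq> carrier (SL2 k) \<times> carrier (SL2 k)"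
    using xy by (auto simp: dir_power_def)
  ultimately have "card {..<d} \<le> card (carrier (SL2 k) \<times> carrier (SL2 k))"
    by (rule card_inj_on_le) (intro finite_cartesian_product finite_SL2 assms(1))
  thus ?thesis
    by (simp only: card_lessThan)
qed

definition delta :: "nat \<Rightarrow> nat"
  where "delta p = (GREATEST d. 0 < d \<and> two_generated (dir_power (SL2 p) d))"

text \<open>The maximum in the definition of \<^const>\<open>delta\<close> is attained, provided that some
  nontrivial direct power is 2-generated.\<close>

lemma delta_greatest:
  assumes "p > 0" "0 < d" "two_generated (dir_power (SL2 p) d)"
  shows "0 < delta p" "two_generated (dir_power (SL2 p) (delta p))" "d \<le> delta p"
proof -
  let ?Q = "\<lambda>d. 0 < d \<and> two_generated (dir_power (SL2 p) d)"
  have bound: "\<And>e. ?Q e \<Longrightarrow> e \<le> card (carrier (SL2 p) \<times> carrier (SL2 p))"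
    using two_generated_dir_power_SL2_le[OF assms(1)] by blast
  have "?Q d" using assms by simp
  have "?Q (delta p)"
    unfolding delta_def by (rule GreatestI_nat[of ?Q, OF \<open>?Q d\<close> bound])
  thus "0 < delta p" "two_generated (dir_power (SL2 p) (delta p))"
    by blast+
  show "d \<le> delta p"
    unfolding delta_def by (rule Greatest_le_nat[of ?Q, OF \<open>?Q d\<close> bound])
qed

definition Gp :: "nat \<Rightarrow> (nat \<Rightarrow> bit alg_closure ^ 2 ^ 2) monoid"
  where "Gp p = dir_power (SL2 p) (delta p)"

section \<open>Graphs\<close>

text \<open>A simple graph is a symmetric loopless digraph whose arcs are ordered pairs of vertices.
  Its connected components are then the strongly connected components \<^const>\<open>pre_digraph.sccs\<close>
  of the digraph.\<close>

definition simple_graph :: "'a set \<Rightarrow> ('a \<Rightarrow> 'a \<Rightarrow> bool) \<Rightarrow> ('a, 'a \<times> 'a) pre_digraph"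
  where "simple_graph V adj =
    \<lparr>verts = V, arcs = {(x, y). x \<in> V \<and> y \<in> V \<and> x \<noteq> y \<and> adj x y}, tail = fst, head = snd\<rparr>"

definition remove_isolated :: "('a, 'b) pre_digraph \<Rightarrow> ('a, 'b) pre_digraph"
  where "remove_isolated \<Gamma> =
    \<Gamma> \<restriction> {v \<in> verts \<Gamma>. \<not> (in_arcs \<Gamma> v = {} \<and> out_arcs \<Gamma> v = {})}"

lemma wf_simple_graph: "wf_digraph (simple_graph V adj)"
  by unfold_locales (auto simp: simple_graph_def)

lemma symmetric_simple_graph:
  assumes "\<And>x y. adj x y \<Longrightarrow> adj y x"
  shows "symmetric (simple_graph V adj)"
  using assms by (auto simp: symmetric_def sym_def arcs_ends_conv simple_graph_def)

lemma wf_remove_isolated: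
  assumes "wf_digraph \<Gamma>"
  shows "wf_digraph (remove_isolated \<Gamma>)"
  using assms unfolding remove_isolated_def wf_digraph_def induce_subgraph_def by auto

lemma symmetric_remove_isolated:
  assumes "wf_digraph \<Gamma>" "symmetric \<Gamma>"
  shows "symmetric (remove_isolated \<Gamma>)"
proof -
  have "arcs_ends (remove_isolated \<Gamma>) = arcs_ends \<Gamma>"
    using assms(1)
    by (auto simp: remove_isolated_def arcs_ends_conv induce_subgraph_def in_arcs_def out_arcs_def
        wf_digraph_def)
  thus ?thesis using assms(2) by (simp add: symmetric_def)
qed

text \<open>The distance \<^const>\<open>wf_digraph.\<mu>\<close> with unit weights is \<open>\<infinity>\<close> for vertices in different
  components.\<close>

definition diameter :: "('a, 'b) pre_digraph \<Rightarrow> ereal"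
  where "diameter \<Gamma> = (SUP u\<in>verts \<Gamma>. SUP v\<in>verts \<Gamma>. wf_digraph.\<mu> \<Gamma> (\<lambda>_. 1) u v)"

definition generating_graph :: "('a, 'b) monoid_scheme \<Rightarrow> ('a, 'a \<times> 'a) pre_digraph"
  where "generating_graph H = simple_graph (carrier H) (\<lambda>x y. generate H {x, y} = carrier H)"

definition Delta :: "('a, 'b) monoid_scheme \<Rightarrow> ('a, 'a \<times> 'a) pre_digraph"
  where "Delta H = remove_isolated (generating_graph H)"

lemma sym_digraph_Delta: "sym_digraph (Delta H)"
  unfolding sym_digraph_def sym_digraph_axioms_def Delta_def generating_graph_def
  by (intro conjI wf_remove_isolated wf_simple_graph symmetric_remove_isolated
      symmetric_simple_graph) (simp add: insert_commute)

text \<open>A topological group is given by a group \<open>G\<close> and a topology \<open>T\<close> on its carrier; the closed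
  subgroup topologically generated by a set is the closure of the subgroup it generates.\<close>

definition virt_generating_graph ::
    "('a, 'b) monoid_scheme \<Rightarrow> 'a topology \<Rightarrow> ('a, 'a \<times> 'a) pre_digraph"
  where "virt_generating_graph G T =
    simple_graph (carrier G) (\<lambda>x y. openin T (T closure_of (generate G {x, y})))"

definition Delta_virt :: "('a, 'b) monoid_scheme \<Rightarrow> 'a topology \<Rightarrow> ('a, 'a \<times> 'a) pre_digraph"
  where "Delta_virt G T = remove_isolated (virt_generating_graph G T)"

lemma sym_digraph_Delta_virt: "sym_digraph (Delta_virt G T)"
  unfolding sym_digraph_def sym_digraph_axioms_def Delta_virt_def virt_generating_graph_def
  by (intro conjI wf_remove_isolated wf_simple_graph symmetric_remove_isolated
      symmetric_simple_graph) (simp add: insert_commute)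

section \<open>The profinite group\<close>

definition prodG :: "(nat \<Rightarrow> nat) \<Rightarrow> (nat \<Rightarrow> nat \<Rightarrow> bit alg_closure ^ 2 ^ 2) monoid"
  where "prodG p = product_group UNIV (\<lambda>n. Gp (p n))"

definition prodG_topology :: "(nat \<Rightarrow> nat) \<Rightarrow> (nat \<Rightarrow> nat \<Rightarrow> bit alg_closure ^ 2 ^ 2) topology"
  where "prodG_topology p = product_topology (\<lambda>n. discrete_topology (carrier (Gp (p n)))) UNIV"

lemma topspace_prodG: "topspace (prodG_topology p) = carrier (prodG p)"
  by (simp add: prodG_topology_def prodG_def)

lemma group_prodG: "group (prodG p)"
  unfolding prodG_def Gp_def dir_power_def by (simp add: group_SL2)

end

theory Submission
  imports Defs "HOL-Number_Theory.Number_Theory"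
begin

text \<open>If \<open>\<langle>x, y\<rangle>\<close> is open in the product, then almost all coordinates of \<open>x\<close> and \<open>y\<close> generate, so two
  vertices in the same component have coordinates at bounded distance from some index on. As the
  diameters of the factors grow, sequences built from pairs of far-apart vertices \<open>a n\<close>, \<open>b n\<close>
  that differ infinitely often lie in different components.

  Such sequences are not isolated, because elements that generate in each coordinate generate the
  product topologically. Indeed, a torus element of a factor for the prime \<open>p\<close> has order dividing
  \<open>2\<^sup>p - 1\<close>, which is coprime to \<open>2\<^sup>q (2\<^bsup>2q\<^esup> - 1)\<close> for the other primes \<open>q\<close>. Hence a suitable
  power of a lift of it to the generated subgroup becomes trivial in any finitely many other
  coordinates, and the normal closure of the torus elements is the whole factor. This avoids
  the simplicity of \<open>SL(2, 2\<^sup>p)\<close>.\<close>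

section \<open>Normal subgroups of \<open>SL(2, 2\<^sup>k)\<close>\<close>

definition mat2 :: "'a \<Rightarrow> 'a \<Rightarrow> 'a \<Rightarrow> 'a \<Rightarrow> 'a ^ 2 ^ 2"
  where "mat2 a b c d = (\<chi> i j. if i = 1 then if j = 1 then a else b else if j = 1 then c else d)"

lemma mat2_nth [simp]:
  "mat2 a b c d $ 1 $ 1 = a" "mat2 a b c d $ 1 $ 2 = b"
  "mat2 a b c d $ 2 $ 1 = c" "mat2 a b c d $ 2 $ 2 = d"
  by (simp_all add: mat2_def)

lemma mat2_eta: "mat2 (A $ 1 $ 1) (A $ 1 $ 2) (A $ 2 $ 1) (A $ 2 $ 2) = A"
  by (simp add: vec_eq_iff forall_2)

lemma mat2_inject [simp]:
  "mat2 a b c d = mat2 a' b' c' d' \<longleftrightarrow> a = a' \<and> b = b' \<and> c = c' \<and> d = d'"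
  by (simp add: vec_eq_iff forall_2)

lemma mat_1_eq_mat2: "mat 1 = mat2 1 0 0 (1 :: 'a :: zero_neq_one)"
  by (simp add: vec_eq_iff forall_2 mat_def)

lemma mat2_in_SL2_iff [simp]:
  "mat2 a b c d \<in> carrier (SL2 k) \<longleftrightarrow>
     a \<in> GF2 k \<and> b \<in> GF2 k \<and> c \<in> GF2 k \<and> d \<in> GF2 k \<and> a * d - b * c = 1"
  by (auto simp: SL_def det_2 forall_2)

lemma mult_mat2 [simp]:
  "mat2 a b c d \<otimes>\<^bsub>SL K\<^esub> mat2 a' b' c' d' =
     mat2 (a * a' + b * c') (a * b' + b * d') (c * a' + d * c') (c * b' + d * d')"
  by (simp add: SL_def vec_eq_iff forall_2 matrix_matrix_mult_def sum_2)

lemma one_SL_mat2: "\<one>\<^bsub>SL K\<^esub> = mat2 1 0 0 (1 :: 'a :: comm_ring_1)"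
  by (simp add: SL_def mat_1_eq_mat2)

lemma inv_mat2:
  assumes "mat2 a b c d \<in> carrier (SL2 k)"
  shows "inv\<^bsub>SL2 k\<^esub> (mat2 a b c d) = mat2 d (- b) (- c) a"
  using assms by (intro group.inv_equality[OF group_SL2])
    (auto simp: one_SL_mat2 GF2_uminus algebra_simps)

lemma SL2_elim:
  assumes "A \<in> carrier (SL2 k)"
  obtains a b c d where "A = mat2 a b c d" "a \<in> GF2 k" "b \<in> GF2 k" "c \<in> GF2 k" "d \<in> GF2 k"
    "a * d - b * c = 1"
  using assms mat2_eta[of A] by (metis mat2_in_SL2_iff)

lemma diag_pow:
  fixes a b :: "bit alg_closure"
  shows "mat2 a 0 0 b [^]\<^bsub>SL2 k\<^esub> (n :: nat) = mat2 (a ^ n) 0 0 (b ^ n)"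
  by (induction n) (simp_all add: one_SL_mat2 nat_pow_def mult.commute)

lemma finite_GF2: "k > 0 \<Longrightarrow> finite (GF2 k)"
  using card_GF2[of k] by (metis card.infinite power_not_zero zero_neq_numeral)

text \<open>One factor \<open>a\<close> cancels from \<open>a ^ (2 ^ k) = a\<close>. This is what
  bounds the order of the torus elements.\<close>

lemma GF2_pow_minus_1:
  assumes "a \<in> GF2 k" "a \<noteq> 0"
  shows "a ^ (2 ^ k - 1) = 1"
proof -
  have "a * a ^ (2 ^ k - 1) = a ^ (2 ^ k)"
    by (subst power_Suc[symmetric]) simp
  thus ?thesis using assms by (simp add: GF2_def)
qed

lemma GF2_diff: "x \<in> GF2 k \<Longrightarrow> y \<in> GF2 k \<Longrightarrow> x - y \<in> GF2 k"
  using GF2_add[of x k "- y"] by (simp add: GF2_uminus)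

lemma GF2_divide: "x \<in> GF2 k \<Longrightarrow> y \<in> GF2 k \<Longrightarrow> x / y \<in> GF2 k"
  by (simp add: divide_inverse GF2_mult GF2_inverse)

text \<open>Conjugation by \<open>diag(a, 1/a)\<close> scales the off-diagonal entry of a transvection by \<open>a\<^sup>2\<close>, so the
  commutators of the torus with the transvections are all transvections; these generate.\<close>

lemma normal_SL2_eq_carrier:
  assumes k: "k \<ge> 2" and norm: "N \<lhd> SL2 k"
    and torus: "\<And>A. A \<in> carrier (SL2 k) \<Longrightarrow> A [^]\<^bsub>SL2 k\<^esub> (2 ^ k - 1 :: nat) = \<one>\<^bsub>SL2 k\<^esub> \<Longrightarrow> A \<in> N"
  shows "N = carrier (SL2 k)"
proof -
  interpret N: normal N "SL2 k" by (rule norm)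
  have mult: "A \<otimes>\<^bsub>SL2 k\<^esub> B \<in> N" if "A \<in> N" "B \<in> N" for A B
    using that subgroup.m_closed[OF normal_imp_subgroup[OF norm]] by blast
  \<comment> \<open>Here \<open>k \<ge> 2\<close> enters: the field needs an element besides 0 and 1
    for a nontrivial torus.\<close>
  have "card {0, 1 :: bit alg_closure} < card (GF2 k)"
    using k power_increasing[of 2 k "2::nat"] by (simp add: card_GF2)
  then obtain a where a: "a \<in> GF2 k" "a \<noteq> 0" "a \<noteq> 1"
    by (metis card_mono finite.emptyI finite_insert insertCI leD subsetI)
  have inva: "inverse a \<in> GF2 k" by (rule GF2_inverse[OF a(1)])
  have tin: "mat2 a 0 0 (inverse a) \<in> N" "mat2 (inverse a) 0 0 a \<in> N"
    using GF2_pow_minus_1[OF a(1,2)] a inva GF2_0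
    by (auto intro!: torus simp: diag_pow one_SL_mat2 power_inverse)
  \<comment> \<open>In characteristic 2 the expression is \<open>(a - 1) * (a - 1)\<close>.\<close>
  have ne: "a * a - 1 \<noteq> 0"
  proof
    assume "a * a - 1 = 0"
    hence "(a - 1) * (a + 1) = 0" by (simp add: algebra_simps)
    moreover have "a + 1 = a - 1" by (metis uminus_eq diff_conv_add_uminus)
    ultimately show False using a by simp
  qed
  have upper: "mat2 1 b 0 1 \<in> N" if b: "b \<in> GF2 k" for b
  proof -
    \<comment> \<open>The commutator of \<open>diag(a, 1/a)\<close> with the transvection of entry
      \<open>b'\<close> has entry \<open>b' * (a * a - 1)\<close>. It lies in \<open>N\<close>,
      being a torus element times a conjugate of its inverse.\<close>
    define b' where "b' = b / (a * a - 1)"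
    have b': "b' \<in> GF2 k" "b' * (a * a - 1) = b"
      using b a ne by (auto simp: b'_def intro!: GF2_divide GF2_mult GF2_diff GF2_1)
    have "mat2 1 b' 0 1 \<otimes>\<^bsub>SL2 k\<^esub> mat2 (inverse a) 0 0 a \<otimes>\<^bsub>SL2 k\<^esub> inv\<^bsub>SL2 k\<^esub> (mat2 1 b' 0 1) \<in> N"
      by (rule N.inv_op_closed2) (use b' tin in \<open>auto simp: GF2_0 GF2_1\<close>)
    note mult[OF tin(1) this]
    moreover have "a * (b' * inverse a) = b'" using a by simp
    ultimately show ?thesis
      using a b' by (simp add: inv_mat2 GF2_0 GF2_1 algebra_simps)
  qed
  have lower: "mat2 1 0 b 1 \<in> N" if b: "b \<in> GF2 k" for b
  proof -
    define b' where "b' = b / (a * a - 1)"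
    have b': "b' \<in> GF2 k" "b' * (a * a - 1) = b"
      using b a ne by (auto simp: b'_def intro!: GF2_divide GF2_mult GF2_diff GF2_1)
    have "mat2 1 0 b' 1 \<otimes>\<^bsub>SL2 k\<^esub> mat2 a 0 0 (inverse a) \<otimes>\<^bsub>SL2 k\<^esub> inv\<^bsub>SL2 k\<^esub> (mat2 1 0 b' 1) \<in> N"
      by (rule N.inv_op_closed2) (use b' tin in \<open>auto simp: GF2_0 GF2_1\<close>)
    note mult[OF tin(2) this]
    moreover have "a * (b' * inverse a) = b'" using a by simp
    ultimately show ?thesis
      using a b' by (simp add: inv_mat2 GF2_0 GF2_1 algebra_simps)
  qed
  \<comment> \<open>With an invertible lower left entry, the matrix factors as upper, lower, upper
    transvection; the determinant fixes \<open>y\<close>.\<close>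
  have nonzero: "mat2 x y z w \<in> N"
    if xyzw: "x \<in> GF2 k" "z \<in> GF2 k" "w \<in> GF2 k" "x * w - y * z = 1" "z \<noteq> 0" for x y z w
  proof -
    have y: "y = (x * w - 1) / z" using xyzw by (simp add: field_simps)
    have "mat2 1 ((x - 1) / z) 0 1 \<otimes>\<^bsub>SL2 k\<^esub> mat2 1 0 z 1 \<otimes>\<^bsub>SL2 k\<^esub> mat2 1 ((w - 1) / z) 0 1 \<in> N"
      using xyzw by (intro mult upper lower GF2_divide GF2_diff GF2_1)
    thus ?thesis using xyzw(5) unfolding y by (simp add: field_simps)
  qed
  have "A \<in> N" if "A \<in> carrier (SL2 k)" for A
    using that
  proof (rule SL2_elim)
    fix x y z w assume A: "A = mat2 x y z w" "x \<in> GF2 k" "y \<in> GF2 k" "z \<in> GF2 k" "w \<in> GF2 k"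
      "x * w - y * z = 1"
    show ?thesis
    proof (cases "z = 0")
      case False
      thus ?thesis using A nonzero by blast
    next
      case True
      \<comment> \<open>This is \<open>A\<close> times the lower transvection with entry 1. Its
        lower left entry \<open>w\<close> is nonzero because \<open>x * w = 1\<close>.\<close>
      have "mat2 (x + y) y w w \<in> N"
        using A True by (intro nonzero) (auto intro: GF2_add simp: algebra_simps)
      from mult[OF this lower[of "- 1"]] show ?thesis
        using A True by (simp add: GF2_uminus GF2_1)
    qed
  qed
  thus ?thesis using N.subset by blast
qed

section \<open>The order of \<open>SL(2, 2\<^sup>k)\<close>\<close>

text \<open>If the upper left entry is nonzero, the determinant determines the lower right one and
  the others are free. If it is zero, the upper right entry is nonzero and determines the lower left
  one, and the lower right one is free.\<close>

lemma card_SL2: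
  assumes "k > 0"
  shows "card (carrier (SL2 k)) = 2 ^ k * (2 ^ (2 * k) - 1)"
proof -
  let ?F = "GF2 k" and ?q = "2 ^ k :: nat"
  let ?f = "\<lambda>(a, b, c). mat2 a b c ((1 + b * c) / a)"
  let ?g = "\<lambda>(b, d). mat2 0 b (- 1 / b) d"
  let ?D = "(?F - {0}) \<times> ?F \<times> ?F" and ?E = "(?F - {0}) \<times> ?F"
  have fin: "finite ?F" by (rule finite_GF2[OF assms])
  have "carrier (SL2 k) = ?f ` ?D \<union> ?g ` ?E"
  proof (intro equalityI subsetI)
    fix A assume "A \<in> carrier (SL2 k)"
    thus "A \<in> ?f ` ?D \<union> ?g ` ?E"
    proof (rule SL2_elim)
      fix x y z w assume A: "A = mat2 x y z w" "x \<in> ?F" "y \<in> ?F" "z \<in> ?F" "w \<in> ?F"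
        "x * w - y * z = 1"
      show ?thesis
      proof (cases "x = 0")
        case True
        hence "y * z = - 1" using A(6) by (simp add: minus_equation_iff)
        moreover from this have y: "y \<noteq> 0" by auto
        ultimately have "z = - 1 / y" by (metis nonzero_mult_div_cancel_left)
        hence "A = ?g (y, w)" using A True by simp
        thus ?thesis using A y by blast
      next
        case False
        have "A = ?f (x, y, z)" using A False by (simp add: field_simps)
        moreover have "(x, y, z) \<in> ?D" using A False by simp
        ultimately show ?thesis by blast
      qed
    qed
  next
    fix A assume "A \<in> ?f ` ?D \<union> ?g ` ?E"
    then consider x y z where "x \<noteq> 0" "A = ?f (x, y, z)" "x \<in> ?F" "y \<in> ?F" "z \<in> ?F"
      | y w where "y \<noteq> 0" "A = ?g (y, w)" "y \<in> ?F" "w \<in> ?F" by blast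
    thus "A \<in> carrier (SL2 k)"
      by cases (simp_all add: GF2_0 GF2_1 GF2_uminus GF2_divide GF2_add GF2_mult)
  qed
  moreover have "?f ` ?D \<inter> ?g ` ?E = {}" by auto
  moreover have "inj_on ?f ?D" "inj_on ?g ?E" by (auto simp: inj_on_def)
  ultimately have "card (carrier (SL2 k)) = card ?D + card ?E"
    using fin by (simp add: card_Un_disjoint card_image)
  also have "\<dots> = (?q - 1) * ?q * ?q + (?q - 1) * ?q"
    using fin assms by (simp add: card_cartesian_product card_Diff_singleton GF2_0 card_GF2)
  also have "\<dots> = ?q * (2 ^ (2 * k) - 1)"
    by (simp add: algebra_simps power_add power_mult power2_eq_square)
  finally show ?thesis .
qed

text \<open>The order of 2 modulo a common divisor divides both exponents, hence is 1.\<close>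

lemma coprime_two_power_minus_one:
  fixes m n :: nat
  assumes "coprime m n"
  shows "coprime (2 ^ m - 1 :: nat) (2 ^ n - 1)"
proof (rule coprimeI)
  fix d :: nat assume d: "d dvd 2 ^ m - 1" "d dvd 2 ^ n - 1"
  have *: "ord d 2 dvd l" if "d dvd 2 ^ l - 1" for l
    using that by (simp add: cong_altdef_nat flip: ord_divides)
  have "ord d 2 dvd 1"
    using * d assms by (meson coprime_common_divisor)
  hence "[2 ^ 1 = 1] (mod d)" by (subst ord_divides)
  thus "is_unit d" by (simp add: cong_altdef_nat)
qed

text \<open>An odd prime \<open>p\<close> other than \<open>q\<close> is coprime to
  \<open>2 * q\<close>, so the previous lemma handles the factor \<open>2 ^ (2 * q) - 1\<close>; the
  remaining factor is a power of 2.\<close>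

lemma coprime_card_SL2:
  assumes "Factorial_Ring.prime p" "Factorial_Ring.prime q" "p \<noteq> q" "odd p"
  shows "coprime (2 ^ p - 1) (card (carrier (SL2 q)))"
proof -
  have "coprime p (2 * q)"
    using assms by (auto simp: primes_coprime coprime_commute)
  hence "coprime (2 ^ p - 1 :: nat) (2 ^ (2 * q) - 1)"
    by (rule coprime_two_power_minus_one)
  moreover have "coprime (2 ^ p - 1 :: nat) (2 ^ q)"
    using assms by (simp add: prime_gt_0_nat)
  ultimately show ?thesis
    using assms by (simp add: card_SL2 prime_gt_0_nat)
qed

section \<open>Subdirect products of groups\<close>

lemma nat_pow_product_group:
  "x [^]\<^bsub>product_group I F\<^esub> (n :: nat) = (\<lambda>i\<in>I. x i [^]\<^bsub>F i\<^esub> n)"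
  by (induction n) (simp_all add: nat_pow_def fun_eq_iff restrict_def)

lemma (in group) nat_pow_cong_one:
  fixes m n :: nat
  assumes "x \<in> carrier G" "x [^] m = \<one>" "[n = 1] (mod m)"
  shows "x [^] n = x"
proof -
  have d: "ord x dvd m" using assms pow_eq_id by blast
  show ?thesis
  proof (cases "n = 0")
    \<comment> \<open>The congruence then forces \<open>m = 1\<close>, so \<open>x\<close> is
      trivial. The case is separate because \<open>n - 1\<close> is truncated subtraction.\<close>
    case True
    hence "m = 1" using assms(3) by (simp add: cong_0_1_nat')
    thus ?thesis using assms True by simp
  next
    case False
    hence "m dvd n - 1" using assms(3) by (simp add: cong_altdef_nat)
    hence "x [^] (n - 1) = \<one>" using d assms(1) pow_eq_id dvd_trans by blast
    thus ?thesis using False assms(1) nat_pow_Suc[of x "n - 1"] by simp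
  qed
qed

text \<open>Conjugation by an element of \<open>F n\<close> lifts to conjugation by an element of
  \<open>H\<close>, which keeps the coordinates in \<open>J\<close> trivial.\<close>

lemma subdirect_kernel_normal:
  assumes F: "\<And>i. group (F i)" and H: "subgroup H (product_group UNIV F)"
    and surj: "carrier (F n) \<subseteq> (\<lambda>h. h n) ` H"
  shows "{h n | h. h \<in> H \<and> (\<forall>i\<in>J. h i = \<one>\<^bsub>F i\<^esub>)} \<lhd> F n" (is "?K \<lhd> _")
proof -
  interpret P: group "product_group UNIV F" using F by simp
  interpret H: subgroup H "product_group UNIV F" by (rule H)
  interpret Fi: group "F i" for i by (rule F)
  have carr: "h i \<in> carrier (F i)" if "h \<in> H" for h i
    using H.subset that by auto
  have inv: "inv\<^bsub>product_group UNIV F\<^esub> h = (\<lambda>i. inv\<^bsub>F i\<^esub> h i)" if "h \<in> H" for h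
    using inv_product_group[where f = h and I = UNIV and G = F] H.subset F that
    by (auto simp: restrict_def)
  have mult: "(\<lambda>i. g i \<otimes>\<^bsub>F i\<^esub> h i) \<in> H" if "g \<in> H" "h \<in> H" for g h
    using H.m_closed[OF that] by (simp add: restrict_def)
  have invc: "(\<lambda>i. inv\<^bsub>F i\<^esub> h i) \<in> H" if "h \<in> H" for h
    using H.m_inv_closed[OF that] inv[OF that] by simp
  have "subgroup ?K (F n)"
  proof (rule Fi.subgroupI)
    show "?K \<subseteq> carrier (F n)" using carr by auto
    show "?K \<noteq> {}" using H.one_closed by auto
  next
    fix a assume "a \<in> ?K"
    then obtain h where "h \<in> H" "a = h n" "\<forall>i\<in>J. h i = \<one>\<^bsub>F i\<^esub>" by blast
    thus "inv\<^bsub>F n\<^esub> a \<in> ?K" using invc[of h] by force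
  next
    fix a b assume "a \<in> ?K" "b \<in> ?K"
    then obtain h g where "h \<in> H" "a = h n" "\<forall>i\<in>J. h i = \<one>\<^bsub>F i\<^esub>"
      "g \<in> H" "b = g n" "\<forall>i\<in>J. g i = \<one>\<^bsub>F i\<^esub>" by blast
    thus "a \<otimes>\<^bsub>F n\<^esub> b \<in> ?K" using mult[of h g] by force
  qed
  moreover have "x \<otimes>\<^bsub>F n\<^esub> a \<otimes>\<^bsub>F n\<^esub> inv\<^bsub>F n\<^esub> x \<in> ?K" if xa: "x \<in> carrier (F n)" "a \<in> ?K" for x a
  proof -
    obtain g where g: "g \<in> H" "x = g n" using surj xa(1) by blast
    obtain h where h: "h \<in> H" "a = h n" "\<forall>i\<in>J. h i = \<one>\<^bsub>F i\<^esub>"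
      using xa(2) by blast
    have "(\<lambda>i. g i \<otimes>\<^bsub>F i\<^esub> h i \<otimes>\<^bsub>F i\<^esub> inv\<^bsub>F i\<^esub> (g i)) \<in> H"
      using mult[OF mult[OF g(1) h(1)] invc[OF g(1)]] .
    moreover have "\<forall>i\<in>J. g i \<otimes>\<^bsub>F i\<^esub> h i \<otimes>\<^bsub>F i\<^esub> inv\<^bsub>F i\<^esub> (g i) = \<one>\<^bsub>F i\<^esub>"
      using h(3) carr[OF g(1)] by simp
    ultimately show ?thesis
      unfolding g(2) h(2) by (intro CollectI exI[of _ "\<lambda>i. g i \<otimes>\<^bsub>F i\<^esub> h i \<otimes>\<^bsub>F i\<^esub> inv\<^bsub>F i\<^esub> (g i)"] conjI) simp_all
  qed
  ultimately show ?thesis by (simp add: Fi.normal_inv_iff)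
qed

text \<open>A lift of \<open>t\<close> is raised to an exponent that is 1 modulo \<open>m\<close>
  and divisible by the order of every \<open>F i\<close> with \<open>i\<close> in
  \<open>J\<close>.\<close>

lemma subdirect_coprime_lift:
  assumes F: "\<And>i. group (F i)" and H: "subgroup H (product_group UNIV F)"
    and t: "t \<in> (\<lambda>h. h n) ` H" "t [^]\<^bsub>F n\<^esub> (m :: nat) = \<one>\<^bsub>F n\<^esub>"
    and J: "finite J" "\<And>i. i \<in> J \<Longrightarrow> coprime m (order (F i))"
  shows "\<exists>h\<in>H. h n = t \<and> (\<forall>i\<in>J. h i = \<one>\<^bsub>F i\<^esub>)"
proof -
  interpret P: group "product_group UNIV F" using F by simp
  interpret Fi: group "F i" for i by (rule F)
  obtain h where h: "h \<in> H" "t = h n" using t(1) by blast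
  have carr: "h i \<in> carrier (F i)" for i
    using subgroup.subset[OF H] h(1) by auto
  define M where "M = (\<Prod>i\<in>J. order (F i))"
  have "coprime M m"
    unfolding M_def by (rule prod_coprime_left) (use J in \<open>simp add: coprime_commute\<close>)
  then obtain e where e: "[M * e = 1] (mod m)"
    using cong_solve_coprime_nat by auto
  let ?h = "h [^]\<^bsub>product_group UNIV F\<^esub> (M * e)"
  have "?h \<in> H"
    using P.subgroup_int_pow_closed[OF H h(1), of "int (M * e)"] by (simp only: int_pow_int)
  moreover have "?h n = t"
    using Fi.nat_pow_cong_one[OF carr[of n] _ e] t(2) h(2) by (simp add: nat_pow_product_group)
  moreover have "?h i = \<one>\<^bsub>F i\<^esub>" if "i \<in> J" for i
  proof -
    have "order (F i) dvd M * e"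
      unfolding M_def using that J(1) by (intro dvd_mult2 dvd_prodI)
    hence "h i [^]\<^bsub>F i\<^esub> (M * e) = \<one>\<^bsub>F i\<^esub>"
      using Fi.pow_order_eq_1[OF carr[of i]] Fi.nat_pow_pow[OF carr[of i]] by (metis Fi.nat_pow_one dvdE)
    thus ?thesis by (simp add: nat_pow_product_group)
  qed
  ultimately show ?thesis by blast
qed

text \<open>Multiplying lifts of the single coordinates of \<open>z\<close> gives the element; this
  is the finite approximation behind density.\<close>

lemma subgroup_agrees_on_finite:
  assumes F: "\<And>i. group (F i)" and H: "subgroup H (product_group UNIV F)"
    and J: "finite J"
    and lift: "\<And>n g. n \<in> J \<Longrightarrow> g \<in> carrier (F n) \<Longrightarrow>
      \<exists>h\<in>H. h n = g \<and> (\<forall>i\<in>J - {n}. h i = \<one>\<^bsub>F i\<^esub>)"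
    and z: "z \<in> carrier (product_group UNIV F)"
  shows "\<exists>h\<in>H. \<forall>i\<in>J. h i = z i"
proof -
  interpret Fi: group "F i" for i by (rule F)
  \<comment> \<open>The coordinates not yet treated are kept trivial, so that multiplying by the
    next lift sets its coordinate correctly.\<close>
  have "\<exists>h\<in>H. (\<forall>i\<in>J'. h i = z i) \<and> (\<forall>i\<in>J - J'. h i = \<one>\<^bsub>F i\<^esub>)" if "finite J'" "J' \<subseteq> J" for J'
    using that
  proof (induction J' rule: finite_induct)
    case empty
    show ?case by (rule bexI[OF _ subgroup.one_closed[OF H]]) simp
  next
    case (insert n J')
    then obtain h where h: "h \<in> H" "\<forall>i\<in>J'. h i = z i" "\<forall>i\<in>J - J'. h i = \<one>\<^bsub>F i\<^esub>" by blast
    have zc: "z i \<in> carrier (F i)" for i using z by auto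
    obtain g where g: "g \<in> H" "g n = z n" "\<forall>i\<in>J - {n}. g i = \<one>\<^bsub>F i\<^esub>"
      using lift[of n "z n"] insert.prems zc by blast
    have "(\<lambda>i. h i \<otimes>\<^bsub>F i\<^esub> g i) \<in> H"
      using subgroup.m_closed[OF H h(1) g(1)] by (simp add: restrict_def)
    moreover have "h i \<otimes>\<^bsub>F i\<^esub> g i = z i" if "i \<in> insert n J'" for i
      using that h g insert.hyps(2) insert.prems zc[of i] by (cases "i = n") auto
    moreover have "h i \<otimes>\<^bsub>F i\<^esub> g i = \<one>\<^bsub>F i\<^esub>" if "i \<in> J - insert n J'" for i
      using that h g by auto
    ultimately show ?case by (intro bexI conjI ballI)
  qed
  from this[OF J order_refl] show ?thesis by blast
qed

section \<open>Direct powers of \<open>SL2 k\<close> as factors of the profinite group\<close>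

text \<open>The preimage of \<open>N\<close> under each coordinate embedding satisfies the criterion
  for a single \<open>SL2 k\<close>, and the images of these embeddings generate the power.\<close>

lemma normal_dir_power_SL2_eq_carrier:
  assumes k: "k \<ge> 2" and norm: "N \<lhd> dir_power (SL2 k) d"
    and torus: "\<And>A. A \<in> carrier (dir_power (SL2 k) d) \<Longrightarrow>
      A [^]\<^bsub>dir_power (SL2 k) d\<^esub> (2 ^ k - 1 :: nat) = \<one>\<^bsub>dir_power (SL2 k) d\<^esub> \<Longrightarrow> A \<in> N"
  shows "N = carrier (dir_power (SL2 k) d)"
proof -
  let ?S = "SL2 k :: (bit alg_closure ^ 2 ^ 2) monoid" and ?P = "dir_power (SL2 k) d"
  interpret S: group ?S by (rule group_SL2)
  interpret P: group ?P unfolding dir_power_def by (simp add: group_SL2)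
  have N: "subgroup N ?P" by (rule normal_imp_subgroup[OF norm])
  have multP: "x \<otimes>\<^bsub>?P\<^esub> y = (\<lambda>l\<in>{..<d}. x l \<otimes>\<^bsub>?S\<^esub> y l)" for x y
    by (simp add: dir_power_def)
  have oneP: "\<one>\<^bsub>?P\<^esub> = (\<lambda>l\<in>{..<d}. \<one>\<^bsub>?S\<^esub>)" by (simp add: dir_power_def)
  define \<iota> where "\<iota> j A = (\<lambda>l\<in>{..<d}. if l = j then A else \<one>\<^bsub>?S\<^esub>)" for j :: nat and A
  have \<iota>_carrier: "\<iota> j A \<in> carrier ?P" if "A \<in> carrier ?S" for j A
    using that by (auto simp: \<iota>_def dir_power_def)
  have \<iota>_hom: "group_hom ?S ?P (\<iota> j)" for j
    by unfold_locales (use \<iota>_carrier in \<open>auto simp: hom_def multP \<iota>_def fun_eq_iff\<close>)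
  have \<iota>_N: "\<iota> j A \<in> N" if j: "j < d" and A: "A \<in> carrier ?S" for j A
  proof -
    interpret \<iota>: group_hom ?S ?P "\<iota> j" by (rule \<iota>_hom)
    let ?N = "{A \<in> carrier ?S. \<iota> j A \<in> N}"
    have "subgroup ?N ?S"
      by (rule S.subgroupI)
        (auto simp: subgroup.m_closed[OF N] subgroup.m_inv_closed[OF N] subgroup.one_closed[OF N]
          intro!: exI[of _ "\<one>\<^bsub>?S\<^esub>"])
    moreover have "x \<otimes>\<^bsub>?S\<^esub> a \<otimes>\<^bsub>?S\<^esub> inv\<^bsub>?S\<^esub> x \<in> ?N" if "x \<in> carrier ?S" "a \<in> ?N" for x a
      using that \<iota>_carrier by (auto intro!: normal.inv_op_closed2[OF norm])
    ultimately have "?N \<lhd> ?S" by (simp add: S.normal_inv_iff)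
    hence "?N = carrier ?S"
    proof (rule normal_SL2_eq_carrier[OF k])
      fix A assume "A \<in> carrier ?S" "A [^]\<^bsub>?S\<^esub> (2 ^ k - 1 :: nat) = \<one>\<^bsub>?S\<^esub>"
      thus "A \<in> ?N"
        using \<iota>_carrier by (auto intro!: torus simp flip: \<iota>.hom_nat_pow)
    qed
    thus ?thesis using A by blast
  qed
  have "z \<in> N" if z: "z \<in> carrier ?P" for z
  proof -
    have zc: "z l \<in> carrier ?S" if "l < d" for l using z that by (auto simp: dir_power_def)
    \<comment> \<open>Truncations of \<open>z\<close> are built up one coordinate at a time;
      \<open>e = d\<close> gives \<open>z\<close> itself.\<close>
    have "(\<lambda>l\<in>{..<d}. if l < e then z l else \<one>\<^bsub>?S\<^esub>) \<in> N" if "e \<le> d" for e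
      using that
    proof (induction e)
      case 0
      show ?case using subgroup.one_closed[OF N] by (simp add: oneP restrict_def)
    next
      case (Suc e)
      have "(\<lambda>l\<in>{..<d}. if l < e then z l else \<one>\<^bsub>?S\<^esub>) \<otimes>\<^bsub>?P\<^esub> \<iota> e (z e) \<in> N"
        by (intro subgroup.m_closed[OF N] \<iota>_N Suc.IH) (use Suc.prems zc in auto)
      also have "(\<lambda>l\<in>{..<d}. if l < e then z l else \<one>\<^bsub>?S\<^esub>) \<otimes>\<^bsub>?P\<^esub> \<iota> e (z e) =
        (\<lambda>l\<in>{..<d}. if l < Suc e then z l else \<one>\<^bsub>?S\<^esub>)"
        using zc by (auto simp: multP \<iota>_def fun_eq_iff less_Suc_eq)
      finally show ?case .
    qed
    from this[OF order_refl] have "(\<lambda>l\<in>{..<d}. z l) \<in> N"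
      by (simp cong: restrict_cong)
    moreover have "(\<lambda>l\<in>{..<d}. z l) = z"
      using z by (intro extensional_restrict) (simp add: dir_power_def PiE_def)
    ultimately show ?thesis by simp
  qed
  thus ?thesis using subgroup.subset[OF N] by blast
qed

lemma group_Gp: "group (Gp q)"
  by (simp add: Gp_def dir_power_def group_SL2)

lemma order_Gp: "order (Gp q) = card (carrier (SL2 q)) ^ delta q"
  by (simp add: order_def Gp_def dir_power_def card_PiE)

text \<open>The \<open>n\<close>-th coordinates of elements of \<open>H\<close> trivial on
  \<open>J\<close> form a normal subgroup. By coprimality of orders it contains every element killed
  by \<open>2 ^ p n - 1\<close>, and so it is the whole factor. Injectivity of \<open>p\<close>
  makes the primes distinct.\<close>

lemma subdirect_prodG_lift:
  assumes p: "inj p" "\<And>n. Factorial_Ring.prime (p n) \<and> odd (p n)"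
    and H: "subgroup H (prodG p)" and surj: "\<And>n. carrier (Gp (p n)) \<subseteq> (\<lambda>h. h n) ` H"
    and J: "finite J" "n \<notin> J" and g: "g \<in> carrier (Gp (p n))"
  shows "\<exists>h\<in>H. h n = g \<and> (\<forall>i\<in>J. h i = \<one>\<^bsub>Gp (p i)\<^esub>)"
proof -
  let ?K = "{h n | h. h \<in> H \<and> (\<forall>i\<in>J. h i = \<one>\<^bsub>Gp (p i)\<^esub>)}"
  have H': "subgroup H (product_group UNIV (\<lambda>n. Gp (p n)))"
    using H by (simp add: prodG_def)
  have "?K \<lhd> Gp (p n)"
    by (rule subdirect_kernel_normal[OF group_Gp H' surj])
  moreover have "p n \<ge> 2" using p(2) by (simp add: prime_ge_2_nat)
  moreover have "t \<in> ?K" if t: "t \<in> carrier (Gp (p n))"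
    "t [^]\<^bsub>Gp (p n)\<^esub> (2 ^ p n - 1 :: nat) = \<one>\<^bsub>Gp (p n)\<^esub>" for t
  proof -
    have "coprime (2 ^ p n - 1) (order (Gp (p i)))" if "i \<in> J" for i
      unfolding order_Gp using p that J(2)
      by (intro coprime_power_right_iff[THEN iffD2] disjI1 coprime_card_SL2) (auto dest: injD)
    from subdirect_coprime_lift[OF group_Gp H' _ t(2) J(1) this] show ?thesis
      using surj t(1) by blast
  qed
  ultimately have "?K = carrier (Gp (p n))"
    unfolding Gp_def by (intro normal_dir_power_SL2_eq_carrier)
  hence "g \<in> ?K" using g by simp
  thus ?thesis by blast
qed

section \<open>Generating pairs of the profinite group\<close>

lemma generate_product_group_coordinate:
  assumes F: "\<And>i. group (F i)" and x: "x \<in> carrier (product_group UNIV F)"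
    and y: "y \<in> carrier (product_group UNIV F)"
  shows "(\<lambda>h. h n) ` generate (product_group UNIV F) {x, y} = generate (F n) {x n, y n}"
proof -
  have "group_hom (product_group UNIV F) (F n) (\<lambda>h. h n)"
    by (auto simp: group_hom_def group_hom_axioms_def hom_def F)
  from group_hom.generate_img[OF this, of "{x, y}"] show ?thesis
    using x y by simp
qed

text \<open>A basic neighbourhood of \<open>z\<close> constrains only finitely many coordinates, and
  some element of the generated subgroup agrees with \<open>z\<close> on all of them.\<close>

lemma closure_generate_eq_carrier:
  assumes p: "inj p" "\<And>n. Factorial_Ring.prime (p n) \<and> odd (p n)"
    and x: "x \<in> carrier (prodG p)" and y: "y \<in> carrier (prodG p)"
    and gen: "\<And>n. generate (Gp (p n)) {x n, y n} = carrier (Gp (p n))"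
  shows "prodG_topology p closure_of generate (prodG p) {x, y} = carrier (prodG p)"
proof -
  let ?H = "generate (prodG p) {x, y}"
  have H: "subgroup ?H (prodG p)"
    using x y by (intro group.generate_is_subgroup[OF group_prodG]) auto
  have surj: "carrier (Gp (p n)) \<subseteq> (\<lambda>h. h n) ` ?H" for n
    using generate_product_group_coordinate[OF group_Gp, of x p y n] x y gen
    by (simp add: prodG_def)
  have "z \<in> prodG_topology p closure_of ?H" if z: "z \<in> carrier (prodG p)" for z
    unfolding in_closure_of
  proof (intro conjI allI impI)
    show "z \<in> topspace (prodG_topology p)" using z by (simp add: topspace_prodG)
    fix T assume "z \<in> T \<and> openin (prodG_topology p) T"
    then obtain U where U: "finite {i. U i \<noteq> carrier (Gp (p i))}" "z \<in> Pi\<^sub>E UNIV U"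
      "Pi\<^sub>E UNIV U \<subseteq> T"
      by (auto simp: prodG_topology_def openin_product_topology_alt)
    obtain h where h: "h \<in> ?H" "\<forall>i\<in>{i. U i \<noteq> carrier (Gp (p i))}. h i = z i"
      using subgroup_agrees_on_finite[OF group_Gp H[unfolded prodG_def] U(1) _ z[unfolded prodG_def]]
        subdirect_prodG_lift[OF p H surj] U(1) by (auto simp: prodG_def)
    have "h i \<in> carrier (Gp (p i))" for i
      using h(1) subgroup.subset[OF H] by (auto simp: prodG_def)
    hence "h i \<in> U i" for i
      using h(2) U(2) by (cases "U i = carrier (Gp (p i))") (auto simp: PiE_iff)
    hence "h \<in> T" using U(3) by auto
    thus "\<exists>h. h \<in> ?H \<and> h \<in> T" using h(1) by blast
  qed
  thus ?thesis
    using closure_of_subset_topspace[of "prodG_topology p" ?H] by (auto simp: topspace_prodG)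
qed

text \<open>A basic box inside \<open>S\<close> is unrestricted at all large coordinates, so any one
  of these can be changed freely in a point of the box.\<close>

lemma openin_prodG_surj:
  assumes S: "openin (prodG_topology p) S" "S \<noteq> {}"
  shows "\<exists>N. \<forall>n\<ge>N. carrier (Gp (p n)) \<subseteq> (\<lambda>z. z n) ` S"
proof -
  obtain s where "s \<in> S" using S(2) by blast
  then obtain U where U: "finite {i. U i \<noteq> carrier (Gp (p i))}" "s \<in> Pi\<^sub>E UNIV U" "Pi\<^sub>E UNIV U \<subseteq> S"
    using S(1) by (auto simp: prodG_topology_def openin_product_topology_alt)
  obtain N where N: "\<And>i. i \<in> {i. U i \<noteq> carrier (Gp (p i))} \<Longrightarrow> i < N"
    using U(1)[unfolded finite_nat_set_iff_bounded] by blast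
  have "g \<in> (\<lambda>z. z n) ` S" if "n \<ge> N" "g \<in> carrier (Gp (p n))" for n g
  proof -
    have "s(n := g) \<in> Pi\<^sub>E UNIV U"
      using that U(2) N[of n] by (auto simp: PiE_iff)
    hence "s(n := g) \<in> S" using U(3) by blast
    thus ?thesis by (metis fun_upd_same image_eqI)
  qed
  thus ?thesis by blast
qed

text \<open>The open closure projects onto all late factors. By continuity its projection lies in
  the closure of the projected subgroup, and closure in a discrete factor adds nothing.\<close>

lemma eventually_generate_coordinate:
  assumes x: "x \<in> carrier (prodG p)" and y: "y \<in> carrier (prodG p)"
    and op: "openin (prodG_topology p) (prodG_topology p closure_of generate (prodG p) {x, y})"
  shows "\<exists>N. \<forall>n\<ge>N. generate (Gp (p n)) {x n, y n} = carrier (Gp (p n))"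
proof -
  let ?H = "generate (prodG p) {x, y}" and ?T = "prodG_topology p"
  have H: "subgroup ?H (prodG p)"
    using x y by (intro group.generate_is_subgroup[OF group_prodG]) auto
  have "?H \<subseteq> ?T closure_of ?H"
    using subgroup.subset[OF H] by (intro closure_of_subset) (simp add: topspace_prodG)
  hence "?T closure_of ?H \<noteq> {}" using subgroup.one_closed[OF H] by blast
  from openin_prodG_surj[OF op this] obtain N where
    N: "\<And>n. n \<ge> N \<Longrightarrow> carrier (Gp (p n)) \<subseteq> (\<lambda>z. z n) ` (?T closure_of ?H)" by blast
  have "generate (Gp (p n)) {x n, y n} = carrier (Gp (p n))" if "n \<ge> N" for n
  proof -
    let ?D = "discrete_topology (carrier (Gp (p n)))"
    have cont: "continuous_map ?T ?D (\<lambda>z. z n)"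
      unfolding prodG_topology_def by (rule continuous_map_product_projection) simp
    have img: "(\<lambda>h. h n) ` ?H = generate (Gp (p n)) {x n, y n}"
      using generate_product_group_coordinate[OF group_Gp, of x p y n] x y by (simp add: prodG_def)
    have "(\<lambda>h. h n) ` ?H \<subseteq> carrier (Gp (p n))"
      using subgroup.subset[OF H] by (auto simp: prodG_def)
    moreover have "(\<lambda>z. z n) ` (?T closure_of ?H) \<subseteq> ?D closure_of ((\<lambda>h. h n) ` ?H)"
      by (rule continuous_map_image_closure_subset[OF cont])
    ultimately show ?thesis
      using N[OF that] unfolding img by (auto simp: discrete_topology_closure_of)
  qed
  thus ?thesis by blast
qed

section \<open>Components of the virtual generating graph\<close>

lemma arcs_remove_isolated:
  assumes "wf_digraph \<Gamma>"
  shows "arcs (remove_isolated \<Gamma>) = arcs \<Gamma>"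
    and "tail (remove_isolated \<Gamma>) = tail \<Gamma>"
    and "head (remove_isolated \<Gamma>) = head \<Gamma>"
  using assms
  by (auto simp: remove_isolated_def induce_subgraph_def in_arcs_def out_arcs_def wf_digraph_def)

lemma verts_remove_isolated_simple_graph:
  assumes "\<And>x y. adj x y \<Longrightarrow> adj y x"
  shows "verts (remove_isolated (simple_graph V adj)) = {x \<in> V. \<exists>y\<in>V. x \<noteq> y \<and> adj x y}"
  by (auto simp: remove_isolated_def induce_subgraph_def in_arcs_def out_arcs_def simple_graph_def)
    (metis assms)

lemma arcs_Delta:
  "arcs (Delta H) =
     {(x, y). x \<in> carrier H \<and> y \<in> carrier H \<and> x \<noteq> y \<and> generate H {x, y} = carrier H}"
  "tail (Delta H) = fst" "head (Delta H) = snd"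
  unfolding Delta_def generating_graph_def
  by (simp_all add: arcs_remove_isolated wf_simple_graph) (simp_all add: simple_graph_def)

lemma verts_Delta:
  "verts (Delta H) = {x \<in> carrier H. \<exists>y\<in>carrier H. x \<noteq> y \<and> generate H {x, y} = carrier H}"
  unfolding Delta_def generating_graph_def
  by (rule verts_remove_isolated_simple_graph) (simp add: insert_commute)

lemma arcs_Delta_virt:
  "arcs (Delta_virt G T) = {(x, y). x \<in> carrier G \<and> y \<in> carrier G \<and> x \<noteq> y \<and>
     openin T (T closure_of generate G {x, y})}"
  "tail (Delta_virt G T) = fst" "head (Delta_virt G T) = snd"
  unfolding Delta_virt_def virt_generating_graph_def
  by (simp_all add: arcs_remove_isolated wf_simple_graph) (simp_all add: simple_graph_def)

lemma verts_Delta_virt: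
  "verts (Delta_virt G T) = {x \<in> carrier G. \<exists>y\<in>carrier G. x \<noteq> y \<and>
     openin T (T closure_of generate G {x, y})}"
  unfolding Delta_virt_def virt_generating_graph_def
  by (rule verts_remove_isolated_simple_graph) (simp add: insert_commute)

text \<open>Each edge of the virtual graph projects, from some index on, to an edge or to a single
  vertex. Along a path, \<open>k\<close> counts the edges and \<open>N\<close> exceeds all these
  indices.\<close>

lemma reachable_Delta_virt_bounded:
  fixes p :: "nat \<Rightarrow> nat"
  assumes reach: "x \<rightarrow>\<^sup>*\<^bsub>Delta_virt (prodG p) (prodG_topology p)\<^esub> y"
    and x: "\<And>n. x n \<in> verts (Delta (Gp (p n)))"
  shows "\<exists>k N. \<forall>n\<ge>N. \<exists>w. pre_digraph.awalk (Delta (Gp (p n))) (x n) w (y n) \<and> length w \<le> k"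
proof -
  interpret V: sym_digraph "Delta_virt (prodG p) (prodG_topology p)"
    by (rule sym_digraph_Delta_virt)
  interpret D: sym_digraph "Delta (Gp (p n))" for n
    by (rule sym_digraph_Delta)
  show ?thesis
    using reach
  proof (induction rule: V.reachable_induct)
    case base
    have "D.awalk n (x n) [] (x n) \<and> length ([] :: ((nat \<Rightarrow> bit alg_closure ^ 2 ^ 2) \<times> _) list) \<le> 0" for n
      using x by (simp add: D.awalk_Nil_iff)
    thus ?case by blast
  next
    case (step y z)
    from step.hyps(2) have yz: "y \<in> carrier (prodG p)" "z \<in> carrier (prodG p)"
      "openin (prodG_topology p) (prodG_topology p closure_of generate (prodG p) {y, z})"
      by (auto simp: arcs_ends_conv arcs_Delta_virt)
    from eventually_generate_coordinate[OF this] obtain M where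
      M: "\<And>n. n \<ge> M \<Longrightarrow> generate (Gp (p n)) {y n, z n} = carrier (Gp (p n))" by blast
    from step.IH obtain k N where
      kN: "\<And>n. n \<ge> N \<Longrightarrow> \<exists>w. D.awalk n (x n) w (y n) \<and> length w \<le> k" by blast
    have "\<exists>w. D.awalk n (x n) w (z n) \<and> length w \<le> Suc k" if n: "n \<ge> max M N" for n
    proof -
      obtain w where w: "D.awalk n (x n) w (y n)" "length w \<le> k" using kN n by auto
      show ?thesis
      \<comment> \<open>Distinct elements of the product may agree at coordinate \<open>n\<close>;
        as the factor graph has no loops, the walk is then left unchanged.\<close>
      proof (cases "y n = z n")
        case True
        thus ?thesis using w by (intro exI[of _ w]) auto
      next
        case False
        hence "(y n, z n) \<in> arcs (Delta (Gp (p n)))"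
          using M n yz by (auto simp: arcs_Delta prodG_def)
        from D.arc_implies_awalk[OF this] have "D.awalk n (y n) [(y n, z n)] (z n)"
          by (simp add: arcs_Delta)
        from D.awalk_appendI[OF w(1) this] w(2) show ?thesis
          by (intro exI[of _ "w @ [(y n, z n)]"]) simp
      qed
    qed
    thus ?case by blast
  qed
qed

text \<open>Neighbours chosen in every coordinate assemble to \<open>y\<close>; the closed subgroup
  generated by \<open>x\<close> and \<open>y\<close> is the whole group, which is open.\<close>

lemma in_verts_Delta_virt_prodG:
  assumes p: "inj p" "\<And>n. Factorial_Ring.prime (p n) \<and> odd (p n)"
    and x: "\<And>n. x n \<in> verts (Delta (Gp (p n)))"
  shows "x \<in> verts (Delta_virt (prodG p) (prodG_topology p))"
proof -
  have "\<exists>y. \<forall>n. y n \<in> carrier (Gp (p n)) \<and> x n \<noteq> y n \<and>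
      generate (Gp (p n)) {x n, y n} = carrier (Gp (p n))"
    using x by (intro choice) (auto simp: verts_Delta)
  then obtain y where y: "\<And>n. y n \<in> carrier (Gp (p n))" "\<And>n. x n \<noteq> y n"
    "\<And>n. generate (Gp (p n)) {x n, y n} = carrier (Gp (p n))" by blast
  have carr: "x \<in> carrier (prodG p)" "y \<in> carrier (prodG p)"
    using x y(1) by (auto simp: prodG_def verts_Delta)
  have "prodG_topology p closure_of generate (prodG p) {x, y} = topspace (prodG_topology p)"
    using closure_generate_eq_carrier[OF p carr y(3)] by (simp only: topspace_prodG)
  moreover have "x \<noteq> y" using y(2) by auto
  ultimately show ?thesis
    using carr by (auto simp: verts_Delta_virt)
qed

section \<open>Upper bound for the cardinality\<close>

text \<open>A sequence is recovered from its graph, coded as a set of natural numbers.\<close>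

lemma prod_countable_lepoll_nat_set:
  assumes "\<And>n :: nat. countable (A n)"
  shows "(\<Pi>\<^sub>E n\<in>UNIV. A n) \<lesssim> (UNIV :: nat set set)"
proof -
  let ?f = "\<lambda>z. range (\<lambda>n. prod_encode (n, to_nat_on (A n) (z n)))"
  have "inj_on ?f (\<Pi>\<^sub>E n\<in>UNIV. A n)"
  proof (rule inj_onI, rule ext)
    fix z z' n assume z: "z \<in> (\<Pi>\<^sub>E n\<in>UNIV. A n)" "z' \<in> (\<Pi>\<^sub>E n\<in>UNIV. A n)" "?f z = ?f z'"
    have "prod_encode (n, to_nat_on (A n) (z n)) \<in> ?f z'"
      using z(3) by blast
    hence "to_nat_on (A n) (z n) = to_nat_on (A n) (z' n)" by auto
    thus "z n = z' n"
      using z(1,2) inj_on_to_nat_on[OF assms, of n] by (auto dest: inj_onD)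
  qed
  thus ?thesis by (auto simp: lepoll_def)
qed

lemma finite_carrier_Gp: "q > 0 \<Longrightarrow> finite (carrier (Gp q))"
  by (auto simp: Gp_def dir_power_def intro!: finite_PiE finite_SL2)

theorem proposition8:
  fixes p :: "nat \<Rightarrow> nat"
  assumes incr: "strict_mono p"
    and odd_primes: "\<And>n. Factorial_Ring.prime (p n) \<and> odd (p n)"
    and diam: "\<And>n. diameter (Delta (Gp (p n))) \<ge> 2 ^ n"
  shows "pre_digraph.sccs (Delta_virt (prodG p) (prodG_topology p)) \<approx> (UNIV :: nat set set)"
proof -
  interpret V: sym_digraph "Delta_virt (prodG p) (prodG_topology p)"
    by (rule sym_digraph_Delta_virt)
  interpret D: sym_digraph "Delta (Gp (p n))" for n
    by (rule sym_digraph_Delta)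
  have p: "inj p" by (rule strict_mono_imp_inj_on[OF incr])

  \<comment> \<open>Since \<open>n < 2 ^ n\<close>, the bound \<open>n\<close> lies strictly below
    the supremum defining the diameter, so some pair of vertices exceeds it.\<close>
  have "\<exists>u\<in>verts (Delta (Gp (p n))). \<exists>v\<in>verts (Delta (Gp (p n))).
      ereal (real n) < D.\<mu> n (\<lambda>_. 1) u v" for n
  proof -
    have "ereal (real n) < ereal (2 ^ n)"
      using of_nat_less_two_power[of n, where 'a = real] by simp
    also have "\<dots> = 2 ^ n" by simp
    also have "\<dots> \<le> diameter (Delta (Gp (p n)))" by (rule diam)
    finally show ?thesis unfolding diameter_def by (simp add: less_SUP_iff)
  qed
  then obtain a b where ab: "\<And>n. a n \<in> verts (Delta (Gp (p n)))" "\<And>n. b n \<in> verts (Delta (Gp (p n)))"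
    "\<And>n. ereal (real n) < D.\<mu> n (\<lambda>_. 1) (a n) (b n)" by metis
  \<comment> \<open>With unit weights the cost of a walk is its length, and the distance is at most
    that cost.\<close>
  have far: "n < length w" if "D.awalk n (a n) w (b n)" for n w
  proof -
    have "ereal (real n) < D.\<mu> n (\<lambda>_. 1) (a n) (b n)" by (rule ab(3))
    also have "\<dots> \<le> D.awalk_cost (\<lambda>_. 1) w" by (rule D.min_cost_le_walk_cost[OF that])
    also have "D.awalk_cost (\<lambda>_. 1) w = length w"
      by (simp add: D.awalk_cost_def sum_list_triv)
    finally show ?thesis by simp
  qed

  text \<open>Each membership question \<open>m \<in> S\<close> is asked at infinitely many coordinates, so that
    distinct sets give sequences whose coordinates are far apart infinitely often.\<close>
  define c where "c S n = (if fst (prod_decode n) \<in> S then a n else b n)" for S n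
  have c_coord: "c S n \<in> verts (Delta (Gp (p n)))" for S n
    using ab by (simp add: c_def)
  have c_vertex: "c S \<in> verts (Delta_virt (prodG p) (prodG_topology p))" for S
    by (rule in_verts_Delta_virt_prodG[OF p odd_primes c_coord])
  have sub: "S \<subseteq> T" if reach: "c S \<rightarrow>\<^sup>*\<^bsub>Delta_virt (prodG p) (prodG_topology p)\<^esub> c T" for S T
  proof
    fix m assume m: "m \<in> S"
    obtain k N where kN: "\<And>n. n \<ge> N \<Longrightarrow> \<exists>w. D.awalk n (c S n) w (c T n) \<and> length w \<le> k"
      using reachable_Delta_virt_bounded[OF reach c_coord] by blast
    \<comment> \<open>This coordinate asks about \<open>m\<close> and is at least
      \<open>max k N\<close>: beyond \<open>N\<close> a walk of length at most \<open>k\<close>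
      exists, while \<open>far\<close> would make it longer than \<open>k\<close>.\<close>
    let ?n = "prod_encode (m, max k N)"
    have n: "?n \<ge> max k N" by (rule le_prod_encode_2)
    then obtain w where w: "D.awalk ?n (c S ?n) w (c T ?n)" "length w \<le> k"
      using kN by fastforce
    show "m \<in> T"
    proof (rule ccontr)
      assume "m \<notin> T"
      hence "?n < length w" using w(1) m by (intro far) (simp add: c_def)
      thus False using w(2) n by simp
    qed
  qed
  have "inj (\<lambda>S. V.scc_of (c S))"
  proof (rule injI)
    fix S T assume "V.scc_of (c S) = V.scc_of (c T)"
    hence "c T \<in> V.scc_of (c S)"
      using V.in_scc_of_self[OF c_vertex[of T]] by simp
    \<comment> \<open>Vertices of one component reach each other both ways, which gives both
      inclusions.\<close>
    thus "S = T" using sub[of S T] sub[of T S] by (auto simp: V.scc_of_def)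
  qed
  hence lower: "(UNIV :: nat set set) \<lesssim> V.sccs_verts"
    using V.scc_of_in_sccs_verts[OF c_vertex] unfolding lepoll_def by blast

  have "V.sccs_verts \<lesssim> verts (Delta_virt (prodG p) (prodG_topology p))"
    unfolding V.sccs_verts_conv_scc_of by (rule image_lepoll)
  also have "\<dots> \<lesssim> carrier (prodG p)"
    by (rule subset_imp_lepoll) (auto simp: verts_Delta_virt)
  also have "\<dots> \<lesssim> (UNIV :: nat set set)"
    unfolding prodG_def carrier_product_group
    using odd_primes by (intro prod_countable_lepoll_nat_set countable_finite finite_carrier_Gp)
      (simp add: prime_gt_0_nat)
  finally have "V.sccs_verts \<approx> (UNIV :: nat set set)"
    using lower by (intro lepoll_antisym)
  \<comment> \<open>Components are subgraphs, counted so far by their vertex sets; each is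
    determined by its vertex set.\<close>
  moreover have "V.sccs \<approx> V.sccs_verts"
    unfolding V.sccs_verts_conv
    using V.inj_on_verts_sccs by (meson eqpoll_sym inj_on_image_eqpoll_self)
  ultimately show ?thesis by (rule eqpoll_trans[rotated])
qed

end
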